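(* Let $k\ge 1$. There exists exactly one binary self-dual $(2k,k)$ convolutional code that has a double upper triangular generator matrix, namely the code $\mathcal{C}=\mathrm{rowspan}(\,I_k\ \ I_k\,)\subset\mathbb{F}_2[z]^{2k}$.
   Context: A binary $(n,k)$ convolutional code is an $\mathbb{F}_2[z]$-submodule $\mathcal{C}\subset\mathbb{F}_2[z]^n$ of rank $k$. A generator matrix of $\mathcal{C}$ is a matrix $G(z)\in\mathbb{F}_2[z]^{k\times n}$ whose rows form a basis of $\mathcal{C}$; $\mathrm{rowspan}$ denotes the $\mathbb{F}_2[z]$-span of the rows. The dual is $\mathcal{C}^\perp=\{f(z)\in\mathbb{F}_2[z]^n : f(z)c(z)^\top=0\ \forall c(z)\in\mathcal{C}\}$, and $\mathcal{C}$ is self-dual if $\mathcal{C}=\mathcal{C}^\perp$. A matrix $G(z)=(g_{i,j}(z))\in\mathbb{F}_2[z]^{k\times 2k}$ is called double upper triangular if $G(z)=(A(z)\ \ B(z))$ with $A(z),B(z)\in\mathbb{F}_2[z]^{k\times k}$ both upper triangular, i.e. $g_{i,j}=0$ and $g_{i,k+j}=0$ whenever $1\le j<i\le k$. $I_k$ is the $k\times k$ identity matrix. *)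

theory Defs
  imports "HOL-Library.Z2" "Jordan_Normal_Form.VS_Connect"
begin

type_synonym F2z = "bit poly"

abbreviation F2z_module :: "nat \<Rightarrow> (F2z, F2z vec) module" where
  "F2z_module n \<equiv> module_vec TYPE(F2z) n"

abbreviation F2z_span :: "nat \<Rightarrow> F2z vec set \<Rightarrow> F2z vec set" where
  "F2z_span n \<equiv> LinearCombinations.module.span class_ring (F2z_module n)"

abbreviation F2z_lin_indpt :: "nat \<Rightarrow> F2z vec set \<Rightarrow> bool" where
  "F2z_lin_indpt n \<equiv> LinearCombinations.module.lin_indpt class_ring (F2z_module n)"

definition basis_of :: "nat \<Rightarrow> F2z vec set \<Rightarrow> F2z vec set \<Rightarrow> bool" where
  "basis_of n C B \<longleftrightarrow> B \<subseteq> C \<and> F2z_lin_indpt n B \<and> F2z_span n B = C"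

text \<open>As the polynomial ring over a field is a principal ideal domain, every submodule of a free
  module of rank \<open>n\<close> is free, and its rank is the number of elements of a basis.\<close>

definition convolutional_code :: "nat \<Rightarrow> nat \<Rightarrow> F2z vec set \<Rightarrow> bool" where
  "convolutional_code n k C \<longleftrightarrow>
     LinearCombinations.submodule class_ring C (F2z_module n) \<and>
     (\<exists>B. basis_of n C B \<and> finite B \<and> card B = k)"

definition rowspan :: "F2z mat \<Rightarrow> F2z vec set" where
  "rowspan G = F2z_span (dim_col G) (set (rows G))"

text \<open>Linear independence is a property of sets here, so repeated rows are excluded separately.\<close>

definition generator_matrix :: "nat \<Rightarrow> nat \<Rightarrow> F2z vec set \<Rightarrow> F2z mat \<Rightarrow> bool" where
  "generator_matrix n k C G \<longleftrightarrow>
     G \<in> carrier_mat k n \<and> distinct (rows G) \<and> basis_of n C (set (rows G))"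

definition dual_code :: "nat \<Rightarrow> F2z vec set \<Rightarrow> F2z vec set" where
  "dual_code n C = {f \<in> carrier_vec n. \<forall>c \<in> C. f \<bullet> c = 0}"

definition self_dual :: "nat \<Rightarrow> F2z vec set \<Rightarrow> bool" where
  "self_dual n C \<longleftrightarrow> C = dual_code n C"

definition append_cols :: "'a::zero mat \<Rightarrow> 'a mat \<Rightarrow> 'a mat" (infixr \<open>@\<^sub>c\<close> 65) where
  "A @\<^sub>c B = four_block_mat A B (0\<^sub>m 0 (dim_col A)) (0\<^sub>m 0 (dim_col B))"

definition double_upper_triangular :: "nat \<Rightarrow> F2z mat \<Rightarrow> bool" where
  "double_upper_triangular k G \<longleftrightarrow>
     (\<exists>A \<in> carrier_mat k k. \<exists>B \<in> carrier_mat k k.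
        G = A @\<^sub>c B \<and> upper_triangular A \<and> upper_triangular B)"

end

theory Submission
  imports Defs
begin

text \<open>Let \<open>(A B)\<close> be a double upper triangular generator matrix of a self-dual code \<open>C\<close>. Its rows
  are pairwise orthogonal. Reading these relations from the last column to the first, and using that
  in characteristic 2 the relation \<open>a\<^sup>2 + b\<^sup>2 = 0\<close> forces \<open>a = b\<close>, one finds \<open>A = B\<close> column by
  column; the diagonal entries one has to cancel are nonzero because the rows are independent.
  So \<open>C\<close> is contained in \<open>D = rowspan (I I)\<close>, which is contained in its own dual. Hence
  \<open>D \<subseteq> D\<^sup>\<bottom> \<subseteq> C\<^sup>\<bottom> = C\<close>.\<close>

section \<open>Row spans and independence of rows as statements about the transposed matrix\<close>

context idom_vec
begin

lemma span_rows_eq: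
  assumes G: "G \<in> carrier_mat k n"
  shows "span (set (rows G)) = {transpose_mat G *\<^sub>v x | x. x \<in> carrier_vec k}"
proof -
  have sub: "set (rows G) \<subseteq> carrier_vec n"
    using G by (auto simp: rows_def)
  have len: "length (rows G) = k"
    using G by simp
  have mat: "mat_of_cols n (rows G) = transpose_mat G"
    using G by (metis carrier_matD(2) cols_transpose index_transpose_mat(2) mat_of_cols_cols)
  have "lincomb_list c (rows G) = transpose_mat G *\<^sub>v vec k c" for c
    using lincomb_list_as_mat_mult[of "rows G" c] sub unfolding mat len
    by (metis carrier_vecD subset_code(1))
  then have "span_list (rows G) = {transpose_mat G *\<^sub>v vec k c | c. True}"
    by (auto simp: span_list_def)
  also have "\<dots> = {transpose_mat G *\<^sub>v x | x. x \<in> carrier_vec k}"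
    by auto (metis dim_vec vec_carrier eq_vecI index_vec carrier_vecD)+
  finally show ?thesis
    using span_list_as_span[OF sub] by simp
qed

text \<open>\<open>lin_indpt\<close> takes coefficients as functions on vectors, a matrix product
  takes them by row index. Distinctness of the rows makes the two kinds of coefficients
  correspond.\<close>

lemma lin_indpt_rows_iff:
  assumes G: "G \<in> carrier_mat k n" and dist: "distinct (rows G)"
  shows "lin_indpt (set (rows G)) \<longleftrightarrow>
    (\<forall>x \<in> carrier_vec k. transpose_mat G *\<^sub>v x = 0\<^sub>v n \<longrightarrow> x = 0\<^sub>v k)"
proof -
  have sub: "set (rows G) \<subseteq> carrier_vec n"
    using G by (auto simp: rows_def)
  have len: "length (rows G) = k"
    using G by simp
  have mat: "mat_of_cols n (rows G) = transpose_mat G"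
    using G by (metis carrier_matD(2) cols_transpose index_transpose_mat(2) mat_of_cols_cols)
  have comb: "lincomb f (set (rows G)) = transpose_mat G *\<^sub>v vec k (\<lambda>i. f (row G i))" for f
  proof -
    have "lincomb f (set (rows G)) = transpose_mat G *\<^sub>v vec k (\<lambda>i. f (rows G ! i))"
      using lincomb_as_lincomb_list_distinct[OF sub dist, of f]
        lincomb_list_as_mat_mult[of "rows G" "\<lambda>i. f (rows G ! i)"] sub
      unfolding mat len by (metis carrier_vecD subset_code(1))
    also have "vec k (\<lambda>i. f (rows G ! i)) = vec k (\<lambda>i. f (row G i))"
      using G by auto
    finally show ?thesis .
  qed
  show ?thesis
  proof (intro iffI ballI impI)
    fix x assume li: "lin_indpt (set (rows G))" and x: "x \<in> carrier_vec k"
      and zero: "transpose_mat G *\<^sub>v x = 0\<^sub>v n"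
    \<comment> \<open>The coordinates of \<open>x\<close> carried over to the rows; the description
      is unique because no row occurs twice.\<close>
    define f where "f v = x $ (THE i. i < k \<and> row G i = v)" for v
    have f_row: "f (row G i) = x $ i" if "i < k" for i
    proof -
      have "(THE i'. i' < k \<and> row G i' = row G i) = i"
        using that dist G
        by (intro the_equality) (metis, metis carrier_matD(1) length_rows nth_eq_iff_index_eq nth_rows)
      then show ?thesis
        by (simp add: f_def)
    qed
    have "vec k (\<lambda>i. f (row G i)) = x"
      using x f_row by auto
    then have "lincomb f (set (rows G)) = 0\<^sub>v n"
      using comb zero by simp
    then have "f v = 0" if "v \<in> set (rows G)" for v
      using li that lin_dep_crit[where A = "set (rows G)" and S = "set (rows G)" and a = f and v = v]
      by auto
    then have "x $ i = 0" if "i < k" for i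
      using f_row[OF that] that G by (metis carrier_matD(1) length_rows nth_mem nth_rows)
    then show "x = 0\<^sub>v k"
      using x by auto
  next
    assume inj: "\<forall>x \<in> carrier_vec k. transpose_mat G *\<^sub>v x = 0\<^sub>v n \<longrightarrow> x = 0\<^sub>v k"
    show "lin_indpt (set (rows G))"
    proof (rule finite_lin_indpt2)
      fix f assume "lincomb f (set (rows G)) = 0\<^sub>v n"
      then have "vec k (\<lambda>i. f (row G i)) = 0\<^sub>v k"
        using inj comb by auto
      then have "f (row G i) = 0" if "i < k" for i
        using that by (metis index_vec index_zero_vec(1))
      then show "\<forall>v \<in> set (rows G). f v = 0"
        using G by (auto simp: rows_def)
    qed (use sub in auto)
  qed
qed

end

section \<open>Orthogonality of upper triangular pairs in characteristic 2\<close>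

lemma transpose_mult_mat_vec_index:
  assumes "G \<in> carrier_mat k n" "x \<in> carrier_vec k" "l < n"
  shows "(transpose_mat G *\<^sub>v x) $ l = (\<Sum>i<k. G $$ (i, l) * x $ i)"
  using assms by (auto simp: scalar_prod_def atLeast0LessThan intro!: sum.cong)

text \<open>Pairing coordinate \<open>l\<close> with \<open>k + l\<close> lets equal contributions
  of the two halves cancel term by term.\<close>

lemma scalar_prod_double:
  fixes v w :: "'a :: comm_semiring_0 vec"
  assumes "v \<in> carrier_vec (2 * k)" "w \<in> carrier_vec (2 * k)"
  shows "v \<bullet> w = (\<Sum>l<k. v $ l * w $ l + v $ (k + l) * w $ (k + l))"
proof -
  have split: "(\<Sum>l<k + m. f l) = (\<Sum>l<k. f l) + (\<Sum>l<m. f (k + l))" for f :: "nat \<Rightarrow> 'a" and m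
    by (induction m) (auto simp: add.assoc)
  have "v \<bullet> w = (\<Sum>l<k + k. v $ l * w $ l)"
    using assms by (auto simp: scalar_prod_def atLeast0LessThan mult_2)
  also have "\<dots> = (\<Sum>l<k. v $ l * w $ l) + (\<Sum>l<k. v $ (k + l) * w $ (k + l))"
    by (rule split)
  finally show ?thesis
    by (simp add: sum.distrib)
qed

text \<open>\<open>orth\<close> says that the rows of \<open>(A B)\<close> are orthogonal to each
  other and to themselves, \<open>inj\<close> that they are independent. Both are phrased without
  concatenation, so that only matrix entries are involved.\<close>

lemma upper_triangular_self_orthogonal_eq:
  fixes A B :: "'a :: idom mat"
  assumes char2: "(2 :: 'a) = 0"
    and A: "A \<in> carrier_mat k k" "upper_triangular A"
    and B: "B \<in> carrier_mat k k" "upper_triangular B"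
    and orth: "\<And>i j. i < k \<Longrightarrow> j < k \<Longrightarrow>
      (\<Sum>l<k. A $$ (i, l) * A $$ (j, l) + B $$ (i, l) * B $$ (j, l)) = 0"
    and inj: "\<And>x. x \<in> carrier_vec k \<Longrightarrow> transpose_mat A *\<^sub>v x = 0\<^sub>v k \<Longrightarrow>
      transpose_mat B *\<^sub>v x = 0\<^sub>v k \<Longrightarrow> x = 0\<^sub>v k"
  shows "A = B"
proof -
  have double: "x + x = 0" for x :: 'a
    using char2 by (metis mult_2 mult_zero_left)
  have eqI: "x = y" if "x + y = 0" for x y :: 'a
    using that double by (metis add_right_cancel)
  have zA: "A $$ (i, l) = 0" if "l < i" "i < k" for i l
    using that A by auto
  have zB: "B $$ (i, l) = 0" if "l < i" "i < k" for i l
    using that B by auto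
  have col_eq: "\<forall>i<k. A $$ (i, m) = B $$ (i, m)" if "m < k" for m
    using that
  proof (induction "k - m" arbitrary: m rule: less_induct)
    case less
    have right: "A $$ (i, l) = B $$ (i, l)" if "m < l" "l < k" "i < k" for i l
      using less that by auto
    \<comment> \<open>In the product of rows \<open>i\<close> and \<open>m\<close>, columns left of
      \<open>m\<close> vanish because row \<open>m\<close> does there, and columns right of
      \<open>m\<close> contribute a doubled term. Only column \<open>m\<close> survives.\<close>
    have reduce: "A $$ (i, m) * A $$ (m, m) + B $$ (i, m) * B $$ (m, m) = 0" if "i < k" for i
    proof -
      have "(\<Sum>l<k. A $$ (i, l) * A $$ (m, l) + B $$ (i, l) * B $$ (m, l)) =
        (\<Sum>l\<in>{m}. A $$ (i, l) * A $$ (m, l) + B $$ (i, l) * B $$ (m, l))"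
      proof (rule sum.mono_neutral_right)
        show "\<forall>l\<in>{..<k} - {m}. A $$ (i, l) * A $$ (m, l) + B $$ (i, l) * B $$ (m, l) = 0"
        proof
          fix l assume "l \<in> {..<k} - {m}"
          then consider "l < m" "l < k" | "m < l" "l < k"
            by fastforce
          then show "A $$ (i, l) * A $$ (m, l) + B $$ (i, l) * B $$ (m, l) = 0"
            using zA[of l m] zB[of l m] right[of l] double that less.prems by cases auto
        qed
      qed (use less.prems in auto)
      then show ?thesis
        using orth[OF that less.prems] by simp
    qed
    \<comment> \<open>The case \<open>i = m\<close> of \<open>reduce\<close> is a sum of two
      squares, hence the square of a sum in characteristic 2; a domain has no nonzero
      nilpotents.\<close>
    have "(A $$ (m, m) + B $$ (m, m)) * (A $$ (m, m) + B $$ (m, m)) =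
      (A $$ (m, m) * A $$ (m, m) + B $$ (m, m) * B $$ (m, m)) +
      (A $$ (m, m) * B $$ (m, m) + A $$ (m, m) * B $$ (m, m))"
      by (simp add: algebra_simps)
    also have "\<dots> = 0"
      using reduce[OF less.prems] double by (simp only: add_0)
    finally have diag: "A $$ (m, m) = B $$ (m, m)"
      using eqI by simp
    have lower: "A $$ (i, l) = B $$ (i, l)" if "m \<le> i" "i < k" "l < k" for i l
      using that zA[of l i] zB[of l i] right[of l i] diag
      by (metis le_neq_implies_less linorder_less_linear order_le_less_trans)
    have nonzero: "A $$ (m, m) \<noteq> 0"
    proof
      assume zero: "A $$ (m, m) = 0"
      \<comment> \<open>Replacing the rows above row \<open>m\<close> by unit vectors confines the relations between the rows
        to the rows where \<open>A\<close> and \<open>B\<close> are already known to agree.\<close>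
      define M where "M = mat k k (\<lambda>(i, l). if i < m then (if i = l then 1 else 0) else A $$ (i, l))"
      have M: "M \<in> carrier_mat k k"
        by (simp add: M_def)
      have "upper_triangular M"
        using zA by (auto simp: M_def)
      moreover have "0 \<in> set (diag_mat M)"
        using zero less.prems by (force simp: diag_mat_def M_def)
      \<comment> \<open>A singular matrix over a domain has a nonzero kernel vector with entries in
        the domain itself, as \<open>inj\<close> demands.\<close>
      ultimately have "det (transpose_mat M) = 0"
        using M upper_triangular_imp_det_eq_0_iff det_transpose by metis
      then obtain x where x: "x \<in> carrier_vec k" "x \<noteq> 0\<^sub>v k" "transpose_mat M *\<^sub>v x = 0\<^sub>v k"
        using det_0_iff_vec_prod_zero[of "transpose_mat M" k] M by auto
      have sumM: "(\<Sum>i<k. M $$ (i, l) * x $ i) = 0" if "l < k" for l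
        using transpose_mult_mat_vec_index[OF M x(1) that] x(3) that by simp
      \<comment> \<open>Column \<open>l\<close> of \<open>M\<close> is a unit vector: the first
        \<open>m\<close> rows are those of the identity, and the later ones vanish left of their
        diagonal.\<close>
      have top: "x $ l = 0" if "l < m" for l
      proof -
        have "(\<Sum>i<k. M $$ (i, l) * x $ i) = (\<Sum>i\<in>{l}. M $$ (i, l) * x $ i)"
          using that less.prems zA by (intro sum.mono_neutral_right) (auto simp: M_def)
        then show ?thesis
          using sumM[of l] that less.prems by (simp add: M_def)
      qed
      \<comment> \<open>As \<open>x\<close> vanishes above position \<open>m\<close>, it cannot tell
        \<open>M\<close> from \<open>A\<close>, nor, by \<open>lower\<close>, \<open>A\<close> from
        \<open>B\<close>.\<close>
      have "(\<Sum>i<k. A $$ (i, l) * x $ i) = 0" "(\<Sum>i<k. B $$ (i, l) * x $ i) = 0" if "l < k" for l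
      proof -
        have "(\<Sum>i<k. A $$ (i, l) * x $ i) = (\<Sum>i<k. M $$ (i, l) * x $ i)"
          using that top by (intro sum.cong) (auto simp: M_def)
        then show A0: "(\<Sum>i<k. A $$ (i, l) * x $ i) = 0"
          using sumM that by simp
        have "(\<Sum>i<k. B $$ (i, l) * x $ i) = (\<Sum>i<k. A $$ (i, l) * x $ i)"
          using that top lower by (intro sum.cong) (auto, metis not_less)
        then show "(\<Sum>i<k. B $$ (i, l) * x $ i) = 0"
          using A0 by simp
      qed
      then have "transpose_mat A *\<^sub>v x = 0\<^sub>v k" "transpose_mat B *\<^sub>v x = 0\<^sub>v k"
        using transpose_mult_mat_vec_index[OF A(1) x(1)] transpose_mult_mat_vec_index[OF B(1) x(1)]
          A(1) B(1) by (auto intro!: eq_vecI simp del: index_mult_mat_vec)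
      then show False
        using inj x by blast
    qed
    show ?case
    proof (intro allI impI)
      fix i assume i: "i < k"
      have "(A $$ (i, m) + B $$ (i, m)) * A $$ (m, m) = 0"
        using reduce[OF i] diag by (simp add: algebra_simps)
      then show "A $$ (i, m) = B $$ (i, m)"
        using nonzero eqI by simp
    qed
  qed
  then show ?thesis
    using A B by auto
qed

lemma bit_poly_two_eq_zero: "(2 :: bit poly) = 0"
proof -
  have "(2 :: bit poly) = [:2:]"
    by (simp add: numeral_poly)
  then show ?thesis
    by simp
qed

section \<open>Concatenated matrices and the code generated by \<open>(I I)\<close>\<close>

lemma append_cols_carrier:
  "A \<in> carrier_mat k m \<Longrightarrow> B \<in> carrier_mat k n \<Longrightarrow> A @\<^sub>c B \<in> carrier_mat k (m + n)"
  by (auto simp: append_cols_def)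

lemma append_cols_index:
  assumes "A \<in> carrier_mat k m" "B \<in> carrier_mat k n" "i < k"
  shows "l < m \<Longrightarrow> (A @\<^sub>c B) $$ (i, l) = A $$ (i, l)"
    and "l < n \<Longrightarrow> (A @\<^sub>c B) $$ (i, m + l) = B $$ (i, l)"
  using assms by (auto simp: append_cols_def)

lemma transpose_append_cols_mult_index:
  assumes "A \<in> carrier_mat k m" "B \<in> carrier_mat k n" "x \<in> carrier_vec k"
  shows "l < m \<Longrightarrow> (transpose_mat (A @\<^sub>c B) *\<^sub>v x) $ l = (transpose_mat A *\<^sub>v x) $ l"
    and "l < n \<Longrightarrow> (transpose_mat (A @\<^sub>c B) *\<^sub>v x) $ (m + l) = (transpose_mat B *\<^sub>v x) $ l"
  using assms append_cols_index[OF assms(1,2)]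
    transpose_mult_mat_vec_index[OF append_cols_carrier[OF assms(1,2)] assms(3)]
    transpose_mult_mat_vec_index[OF assms(1,3)] transpose_mult_mat_vec_index[OF assms(2,3)]
  by (simp_all del: index_mult_mat_vec)

lemma rowspan_eq:
  assumes "G \<in> carrier_mat k n"
  shows "rowspan G = {transpose_mat G *\<^sub>v x | x. x \<in> carrier_vec k}"
  using assms idom_vec.span_rows_eq[OF assms] by (auto simp: rowspan_def)

text \<open>Coordinates \<open>l\<close> and \<open>k + l\<close> of a combination of the rows are
  both coordinate \<open>l\<close> of the same combination of the rows of \<open>A\<close>. Equality
  can fail when \<open>A\<close> is not invertible.\<close>

lemma rowspan_append_self_subset:
  assumes A: "A \<in> carrier_mat k k"
  shows "rowspan (A @\<^sub>c A) \<subseteq> {f \<in> carrier_vec (2 * k). \<forall>l<k. f $ l = f $ (k + l)}"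
proof -
  have G: "A @\<^sub>c A \<in> carrier_mat k (2 * k)"
    using append_cols_carrier[OF A A] by (simp add: mult_2)
  show ?thesis
    unfolding rowspan_eq[OF G] using G transpose_append_cols_mult_index[OF A A]
    by (auto simp del: index_mult_mat_vec)
qed

lemma rowspan_one_one:
  "rowspan (1\<^sub>m k @\<^sub>c 1\<^sub>m k) = {f \<in> carrier_vec (2 * k). \<forall>l<k. f $ l = f $ (k + l)}"
proof
  show "rowspan (1\<^sub>m k @\<^sub>c 1\<^sub>m k) \<subseteq> {f \<in> carrier_vec (2 * k). \<forall>l<k. f $ l = f $ (k + l)}"
    by (rule rowspan_append_self_subset) simp
  have G: "(1\<^sub>m k @\<^sub>c 1\<^sub>m k :: F2z mat) \<in> carrier_mat k (2 * k)"
    using append_cols_carrier[of "1\<^sub>m k" k k "1\<^sub>m k" k] by (simp add: mult_2)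
  show "{f \<in> carrier_vec (2 * k). \<forall>l<k. f $ l = f $ (k + l)} \<subseteq> rowspan (1\<^sub>m k @\<^sub>c 1\<^sub>m k)"
  proof clarify
    fix f :: "F2z vec" assume f: "f \<in> carrier_vec (2 * k)" "\<forall>l<k. f $ l = f $ (k + l)"
    \<comment> \<open>For identity blocks the first half of \<open>f\<close> is itself the
      coefficient vector.\<close>
    define x where "x = vec k (\<lambda>l. f $ l)"
    have x: "x \<in> carrier_vec k"
      by (simp add: x_def)
    have "f = transpose_mat (1\<^sub>m k @\<^sub>c 1\<^sub>m k) *\<^sub>v x"
    proof (rule eq_vecI)
      show "dim_vec f = dim_vec (transpose_mat (1\<^sub>m k @\<^sub>c 1\<^sub>m k) *\<^sub>v x)"
        using f carrier_matD(2)[OF G] by simp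
      fix l assume "l < dim_vec (transpose_mat (1\<^sub>m k @\<^sub>c 1\<^sub>m k) *\<^sub>v x)"
      then have "l < 2 * k"
        using carrier_matD(2)[OF G] by simp
      then consider "l < k" | l' where "l = k + l'" "l' < k"
        by (metis add_less_cancel_left le_iff_add mult_2 not_less)
      then show "f $ l = (transpose_mat (1\<^sub>m k @\<^sub>c 1\<^sub>m k) *\<^sub>v x) $ l"
        using transpose_append_cols_mult_index[of "1\<^sub>m k" k k "1\<^sub>m k" k x] x f(2)
        by cases (auto simp del: index_mult_mat_vec simp: x_def)
    qed
    then show "f \<in> rowspan (1\<^sub>m k @\<^sub>c 1\<^sub>m k)"
      unfolding rowspan_eq[OF G] using x by blast
  qed
qed

text \<open>Two words with equal halves are orthogonal, since each product occurs twice. Conversely,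
  orthogonality to enough such words forces equal halves.\<close>

lemma self_dual_rowspan_one_one: "self_dual (2 * k) (rowspan (1\<^sub>m k @\<^sub>c 1\<^sub>m k))"
proof -
  have double: "x + x = 0" for x :: F2z
    using bit_poly_two_eq_zero by (metis mult_2 mult_zero_left)
  have eqI: "x = y" if "x + y = 0" for x y :: F2z
    using that double by (metis add_right_cancel)
  let ?D = "{f :: F2z vec. f \<in> carrier_vec (2 * k) \<and> (\<forall>l<k. f $ l = f $ (k + l))}"
  have "?D \<subseteq> dual_code (2 * k) ?D"
    by (auto simp: dual_code_def scalar_prod_double double)
  moreover have "dual_code (2 * k) ?D \<subseteq> ?D"
  proof
    fix f assume f: "f \<in> dual_code (2 * k) ?D"
    then have f_carrier: "f \<in> carrier_vec (2 * k)"
      by (simp add: dual_code_def)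
    have "f $ l = f $ (k + l)" if l: "l < k" for l
    proof -
      \<comment> \<open>The \<open>l\<close>-th row of \<open>(I I)\<close>, which tests exactly the
        pair of coordinates \<open>l\<close> and \<open>k + l\<close>.\<close>
      define c :: "F2z vec" where "c = vec (2 * k) (\<lambda>i. if i = l \<or> i = k + l then 1 else 0)"
      have c: "c \<in> ?D"
        using l by (auto simp: c_def)
      have "f \<bullet> c = (\<Sum>i<k. f $ i * c $ i + f $ (k + i) * c $ (k + i))"
        using f_carrier c by (intro scalar_prod_double) auto
      also have "\<dots> = (\<Sum>i<k. if i = l then f $ i + f $ (k + i) else 0)"
        using l by (intro sum.cong) (auto simp: c_def)
      also have "\<dots> = f $ l + f $ (k + l)"
        using l by simp
      finally have "f $ l + f $ (k + l) = 0"
        using f c by (simp add: dual_code_def)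
      then show ?thesis
        by (rule eqI)
    qed
    then show "f \<in> ?D"
      using f_carrier by simp
  qed
  ultimately show ?thesis
    unfolding self_dual_def rowspan_one_one by (rule equalityI)
qed

text \<open>The first \<open>k\<close> coordinates tell the rows apart, and in a combination of rows
  they are the coefficients, whence independence.\<close>

lemma generator_matrix_one_one:
  "generator_matrix (2 * k) k (rowspan (1\<^sub>m k @\<^sub>c 1\<^sub>m k)) (1\<^sub>m k @\<^sub>c 1\<^sub>m k)"
proof -
  let ?G = "1\<^sub>m k @\<^sub>c 1\<^sub>m k :: F2z mat"
  have one: "(1\<^sub>m k :: F2z mat) \<in> carrier_mat k k"
    by simp
  have G: "?G \<in> carrier_mat k (2 * k)"
    using append_cols_carrier[OF one one] by (simp add: mult_2)
  interpret idom_vec "2 * k" "TYPE(F2z)" .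
  have sub: "set (rows ?G) \<subseteq> carrier_vec (2 * k)"
    using G by (auto simp: rows_def)
  have "row ?G i $ i = 1" "i \<noteq> j \<Longrightarrow> row ?G j $ i = 0" if "i < k" "j < k" for i j
    using that G append_cols_index(1)[OF one one] by auto
  then have dist: "distinct (rows ?G)"
    using G unfolding distinct_conv_nth by (metis carrier_matD(1) length_rows nth_rows zero_neq_one)
  have "x = 0\<^sub>v k" if x: "x \<in> carrier_vec k" "transpose_mat ?G *\<^sub>v x = 0\<^sub>v (2 * k)" for x
    using transpose_append_cols_mult_index(1)[OF one one x(1)] x by auto
  then have "lin_indpt (set (rows ?G))"
    using lin_indpt_rows_iff[OF G dist] by blast
  moreover have "rowspan ?G = span (set (rows ?G))"
    using G by (simp add: rowspan_def)
  ultimately show ?thesis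
    using G dist in_own_span[OF sub] by (auto simp: generator_matrix_def basis_of_def)
qed

section \<open>From generator matrices to codes, and uniqueness\<close>

lemma generator_matrix_imp_code:
  assumes "generator_matrix n k C G"
  shows "convolutional_code n k C"
proof -
  interpret idom_vec n "TYPE(F2z)" .
  have G: "G \<in> carrier_mat k n" and dist: "distinct (rows G)" and basis: "basis_of n C (set (rows G))"
    using assms by (auto simp: generator_matrix_def)
  have "set (rows G) \<subseteq> carrier_vec n"
    using G by (auto simp: rows_def)
  then have "LinearCombinations.submodule class_ring C (F2z_module n)"
    using span_is_submodule basis by (metis basis_of_def)
  moreover have "card (set (rows G)) = k"
    using dist G by (simp add: distinct_card)
  ultimately show ?thesis
    using basis by (auto simp: convolutional_code_def)
qed

lemma self_dual_double_upper_triangular_eq: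
  assumes sd: "self_dual (2 * k) C" and gen: "generator_matrix (2 * k) k C G"
    and tri: "double_upper_triangular k G"
  shows "C = rowspan (1\<^sub>m k @\<^sub>c 1\<^sub>m k)"
proof -
  let ?D = "rowspan (1\<^sub>m k @\<^sub>c 1\<^sub>m k)"
  obtain A B where A: "A \<in> carrier_mat k k" "upper_triangular A"
    and B: "B \<in> carrier_mat k k" "upper_triangular B" and G_eq: "G = A @\<^sub>c B"
    using tri by (auto simp: double_upper_triangular_def)
  interpret idom_vec "2 * k" "TYPE(F2z)" .
  have G: "G \<in> carrier_mat k (2 * k)" and dist: "distinct (rows G)"
    and C_sub: "set (rows G) \<subseteq> C" and indpt: "lin_indpt (set (rows G))"
    and C_span: "C = rowspan G"
    using gen by (auto simp: generator_matrix_def basis_of_def rowspan_def)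
  have "A = B"
  proof (rule upper_triangular_self_orthogonal_eq[OF bit_poly_two_eq_zero A B])
    fix i j assume ij: "i < k" "j < k"
    have "row G i \<in> C" "row G j \<in> C"
      using C_sub ij G by (auto simp: rows_def)
    then have "row G i \<bullet> row G j = 0"
      using sd by (auto simp: self_dual_def dual_code_def)
    then show "(\<Sum>l<k. A $$ (i, l) * A $$ (j, l) + B $$ (i, l) * B $$ (j, l)) = 0"
      using scalar_prod_double[of "row G i" k "row G j"] ij G append_cols_index[OF A(1) B(1)]
      by (simp add: G_eq)
  next
    fix x assume x: "x \<in> carrier_vec k" "transpose_mat A *\<^sub>v x = 0\<^sub>v k" "transpose_mat B *\<^sub>v x = 0\<^sub>v k"
    \<comment> \<open>A relation between the rows of \<open>G\<close> is a common relation between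
      the rows of \<open>A\<close> and of \<open>B\<close>, so \<open>inj\<close> comes down to
      independence of the rows of \<open>G\<close>.\<close>
    have "transpose_mat G *\<^sub>v x = 0\<^sub>v (2 * k)"
    proof (rule eq_vecI)
      fix l assume "l < dim_vec (0\<^sub>v (2 * k) :: F2z vec)"
      then consider "l < k" | l' where "l = k + l'" "l' < k"
        by (metis add_less_cancel_left index_zero_vec(2) le_iff_add mult_2 not_less)
      then show "(transpose_mat G *\<^sub>v x) $ l = 0\<^sub>v (2 * k) $ l"
        using transpose_append_cols_mult_index[OF A(1) B(1) x(1)] x(2,3)
        by cases (auto simp del: index_mult_mat_vec simp: G_eq)
    qed (use G in simp)
    then show "x = 0\<^sub>v k"
      using lin_indpt_rows_iff[OF G dist] indpt x(1) by blast
  qed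
  then have "C \<subseteq> ?D"
    using rowspan_append_self_subset[OF A(1)] C_span G_eq rowspan_one_one by simp
  \<comment> \<open>Duality reverses the inclusion just shown, and both codes are their own duals.
    Invertibility of \<open>A\<close> thus never has to be proved.\<close>
  moreover have "?D \<subseteq> C"
  proof -
    have "dual_code (2 * k) ?D \<subseteq> dual_code (2 * k) C"
      using \<open>C \<subseteq> ?D\<close> by (auto simp: dual_code_def)
    then show ?thesis
      using sd self_dual_rowspan_one_one[of k] by (auto simp: self_dual_def)
  qed
  ultimately show ?thesis
    by (rule equalityI)
qed

theorem mainTheorem5:
  fixes k :: nat
  assumes "k \<ge> 1"
  shows "{C. convolutional_code (2 * k) k C \<and> self_dual (2 * k) C \<and>
             (\<exists>G. generator_matrix (2 * k) k C G \<and> double_upper_triangular k G)}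
         = {rowspan (1\<^sub>m k @\<^sub>c 1\<^sub>m k)}"
proof -
  have "double_upper_triangular k (1\<^sub>m k @\<^sub>c 1\<^sub>m k)"
    unfolding double_upper_triangular_def by (intro bexI[of _ "1\<^sub>m k"]) auto
  then show ?thesis
    using self_dual_double_upper_triangular_eq self_dual_rowspan_one_one[of k]
      generator_matrix_one_one[of k] generator_matrix_imp_code[OF generator_matrix_one_one[of k]]
    by blast
qed

end
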